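(* Let $n>1$, $\textsf{AP}=\{p\}$, and let $K_n$ and $M_n$ be tree structures as described in the context. Let $\psi$ be a balanced KCTL$^*$ sentence with $|\psi|<n$. Then for every finite set of agents $\textsf{Agts}$ and every observation map $\textit{Obs}:\textsf{Agts}\to 2^{\{p\}}$, $(K_n,\textit{Obs})\models\psi$ if and only if $(M_n,\textit{Obs})\models\psi$.
   Context: Kripke structures, paths, KCTL$^*$ syntax and semantics: a Kripke structure is $K=\langle S,s_0,E,V\rangle$ ($E$ total, $V:S\to 2^{\textsf{AP}}$); KCTL$^*$ formulas $\varphi::=\top\mid p\mid\neg\varphi\mid\varphi\vee\varphi\mid\textsf{X}\varphi\mid\varphi\textsf{U}\varphi\mid\exists\varphi\mid\textsf{K}_a\varphi$, interpreted on initial paths $\pi$ and positions $i$ with synchronous perfect recall: $\exists\varphi$ holds at $(\pi,i)$ iff some initial path $\pi'$ with $\pi'[0,i]=\pi[0,i]$ satisfies $\varphi$ at $i$; $\textsf{K}_a\varphi$ holds at $(\pi,i)$ iff every initial path $\pi'$ with $V(\pi'(j))\cap\textit{Obs}(a)=V(\pi(j))\cap\textit{Obs}(a)$ for all $j\le i$ satisfies $\varphi$ at $i$; $\textsf{X},\textsf{U}$, atoms and Booleans standard. A sentence has every temporal/knowledge modality in the scope of a path quantifier; $(K,\textit{Obs})\models\varphi$ iff $\pi,0\models\varphi$ for some initial $\pi$. $|\psi|$ is the size (length) of $\psi$. $\psi$ is balanced if for every subformula $\psi_1\textsf{U}\psi_2$, $|\psi_1|=|\psi_2|$. A tree structure is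 a Kripke structure whose states (nodes) form a prefix-closed subset of $\mathbb{N}^*$, with root $\varepsilon$ as initial state, and $(\tau,\tau')\in E$ only if $\tau'=\tau\cdot i$ for some $i$. It is regular if it is the unwinding from the initial state of a finite Kripke structure. $K_n$ is any regular tree structure over $2^{\{p\}}$ such that for some $\ell_n>1$: (1) the root has label $\{p\}$ and exactly $2n+1$ successors $\eta,\xi_1,\ldots,\xi_{2n}$, and there is a unique initial path visiting $\eta$ (denoted $\pi(\eta)$) and a unique initial path visiting $\xi_k$ (denoted $\pi(\xi_k)$) for each $k\in[1,2n]$; (2) there are $2n+1$ distinct finite words $w_0,\ldots,w_{2n}$ over $2^{\{p\}}$ of length $\ell_n$ with $w_0=\{p\}^{\ell_n}$, $w_n(\ell_n-1)=\emptyset$, $w_{n-1}(\ell_n-1)=\{p\}$, the trace of $\pi(\eta)$ is $\{p\}\,w_0\,\emptyset^n\{p\}^n\{p\}^\omega$, and for each $k\in[1,2n]$ the trace of $\pi(\xi_k)$ is $\{p\}\,w_k\,\emptyset^{2n-k}\{p\}^k\{p\}^\omega$. $M_n$ is obtained from $K_n$ by replacing the label $\{p\}$ of the node $\pi(\xi_n)(\ell_n+1+n)$ with $\emptyset$. *)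

theory Defs
  imports Main "HOL-Library.Omega_Words_Fun"
begin

record ('s, 'p) kripke =
  states :: "'s set"
  init :: 's
  edges :: "('s \<times> 's) set"
  label :: "'s \<Rightarrow> 'p set"

definition kripke_structure :: "'p set \<Rightarrow> ('s, 'p) kripke \<Rightarrow> bool" where
  "kripke_structure AP K \<longleftrightarrow>
     init K \<in> states K \<and>
     edges K \<subseteq> states K \<times> states K \<and>
     (\<forall>s\<in>states K. \<exists>t. (s, t) \<in> edges K) \<and>
     (\<forall>s\<in>states K. label K s \<subseteq> AP)"

definition initial_path :: "('s, 'p) kripke \<Rightarrow> 's word \<Rightarrow> bool" where
  "initial_path K \<pi> \<longleftrightarrow> \<pi> 0 = init K \<and> (\<forall>i. (\<pi> i, \<pi> (Suc i)) \<in> edges K)"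

definition trace :: "('s, 'p) kripke \<Rightarrow> 's word \<Rightarrow> 'p set word" where
  "trace K \<pi> = label K \<circ> \<pi>"

datatype (atoms: 'p, agents: 'a) kctl =
    Top
  | Atom 'p
  | Neg "('p, 'a) kctl"
  | Or "('p, 'a) kctl" "('p, 'a) kctl"
  | Next "('p, 'a) kctl"
  | Until "('p, 'a) kctl" "('p, 'a) kctl"
  | Exists "('p, 'a) kctl"
  | Knows 'a "('p, 'a) kctl"

primrec sat ::
  "('s, 'p) kripke \<Rightarrow> ('a \<Rightarrow> 'p set) \<Rightarrow> ('p, 'a) kctl \<Rightarrow> 's word \<Rightarrow> nat \<Rightarrow> bool"
where
  "sat K Obs Top \<pi> i \<longleftrightarrow> True"
| "sat K Obs (Atom q) \<pi> i \<longleftrightarrow> q \<in> label K (\<pi> i)"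
| "sat K Obs (Neg \<phi>) \<pi> i \<longleftrightarrow> \<not> sat K Obs \<phi> \<pi> i"
| "sat K Obs (Or \<phi>\<^sub>1 \<phi>\<^sub>2) \<pi> i \<longleftrightarrow> sat K Obs \<phi>\<^sub>1 \<pi> i \<or> sat K Obs \<phi>\<^sub>2 \<pi> i"
| "sat K Obs (Next \<phi>) \<pi> i \<longleftrightarrow> sat K Obs \<phi> \<pi> (Suc i)"
| "sat K Obs (Until \<phi>\<^sub>1 \<phi>\<^sub>2) \<pi> i \<longleftrightarrow>
     (\<exists>j\<ge>i. sat K Obs \<phi>\<^sub>2 \<pi> j \<and> (\<forall>k. i \<le> k \<and> k < j \<longrightarrow> sat K Obs \<phi>\<^sub>1 \<pi> k))"
| "sat K Obs (Exists \<phi>) \<pi> i \<longleftrightarrow>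
     (\<exists>\<pi>'. initial_path K \<pi>' \<and> (\<forall>j\<le>i. \<pi>' j = \<pi> j) \<and> sat K Obs \<phi> \<pi>' i)"
| "sat K Obs (Knows a \<phi>) \<pi> i \<longleftrightarrow>
     (\<forall>\<pi>'. initial_path K \<pi>' \<and>
        (\<forall>j\<le>i. label K (\<pi>' j) \<inter> Obs a = label K (\<pi> j) \<inter> Obs a) \<longrightarrow> sat K Obs \<phi> \<pi>' i)"

definition models :: "('s, 'p) kripke \<Rightarrow> ('a \<Rightarrow> 'p set) \<Rightarrow> ('p, 'a) kctl \<Rightarrow> bool" where
  "models K Obs \<phi> \<longleftrightarrow> (\<exists>\<pi>. initial_path K \<pi> \<and> sat K Obs \<phi> \<pi> 0)"

primrec sentence :: "('p, 'a) kctl \<Rightarrow> bool" where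
  "sentence Top \<longleftrightarrow> True"
| "sentence (Atom q) \<longleftrightarrow> True"
| "sentence (Neg \<phi>) \<longleftrightarrow> sentence \<phi>"
| "sentence (Or \<phi>\<^sub>1 \<phi>\<^sub>2) \<longleftrightarrow> sentence \<phi>\<^sub>1 \<and> sentence \<phi>\<^sub>2"
| "sentence (Next \<phi>) \<longleftrightarrow> False"
| "sentence (Until \<phi>\<^sub>1 \<phi>\<^sub>2) \<longleftrightarrow> False"
| "sentence (Exists \<phi>) \<longleftrightarrow> True"
| "sentence (Knows a \<phi>) \<longleftrightarrow> False"

text \<open>The size that the datatype package generates counts the leaves as \<open>0\<close>; the length of a
  formula is the number of symbols in it, a knowledge modality being one symbol.\<close>

primrec len :: "('p, 'a) kctl \<Rightarrow> nat" where
  "len Top = 1"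
| "len (Atom q) = 1"
| "len (Neg \<phi>) = 1 + len \<phi>"
| "len (Or \<phi>\<^sub>1 \<phi>\<^sub>2) = 1 + len \<phi>\<^sub>1 + len \<phi>\<^sub>2"
| "len (Next \<phi>) = 1 + len \<phi>"
| "len (Until \<phi>\<^sub>1 \<phi>\<^sub>2) = 1 + len \<phi>\<^sub>1 + len \<phi>\<^sub>2"
| "len (Exists \<phi>) = 1 + len \<phi>"
| "len (Knows a \<phi>) = 1 + len \<phi>"

primrec subformulas :: "('p, 'a) kctl \<Rightarrow> ('p, 'a) kctl set" where
  "subformulas Top = {Top}"
| "subformulas (Atom q) = {Atom q}"
| "subformulas (Neg \<phi>) = insert (Neg \<phi>) (subformulas \<phi>)"
| "subformulas (Or \<phi>\<^sub>1 \<phi>\<^sub>2) = insert (Or \<phi>\<^sub>1 \<phi>\<^sub>2) (subformulas \<phi>\<^sub>1 \<union> subformulas \<phi>\<^sub>2)"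
| "subformulas (Next \<phi>) = insert (Next \<phi>) (subformulas \<phi>)"
| "subformulas (Until \<phi>\<^sub>1 \<phi>\<^sub>2) = insert (Until \<phi>\<^sub>1 \<phi>\<^sub>2) (subformulas \<phi>\<^sub>1 \<union> subformulas \<phi>\<^sub>2)"
| "subformulas (Exists \<phi>) = insert (Exists \<phi>) (subformulas \<phi>)"
| "subformulas (Knows a \<phi>) = insert (Knows a \<phi>) (subformulas \<phi>)"

definition balanced :: "('p, 'a) kctl \<Rightarrow> bool" where
  "balanced \<psi> \<longleftrightarrow> (\<forall>\<psi>\<^sub>1 \<psi>\<^sub>2. Until \<psi>\<^sub>1 \<psi>\<^sub>2 \<in> subformulas \<psi> \<longrightarrow> len \<psi>\<^sub>1 = len \<psi>\<^sub>2)"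

definition tree_structure :: "'p set \<Rightarrow> (nat list, 'p) kripke \<Rightarrow> bool" where
  "tree_structure AP T \<longleftrightarrow>
     kripke_structure AP T \<and>
     (\<forall>\<sigma> \<upsilon>. \<sigma> @ \<upsilon> \<in> states T \<longrightarrow> \<sigma> \<in> states T) \<and>
     init T = [] \<and>
     (\<forall>\<tau> \<tau>'. (\<tau>, \<tau>') \<in> edges T \<longrightarrow> (\<exists>i. \<tau>' = \<tau> @ [i]))"

definition finite_initial_paths :: "('s, 'p) kripke \<Rightarrow> 's list set" where
  "finite_initial_paths K =
     {\<rho>. \<rho> \<noteq> [] \<and> hd \<rho> = init K \<and> (\<forall>i. Suc i < length \<rho> \<longrightarrow> (\<rho> ! i, \<rho> ! Suc i) \<in> edges K)}"

definition unwinding :: "('s, 'p) kripke \<Rightarrow> ('s list, 'p) kripke" where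
  "unwinding K =
     \<lparr> states = finite_initial_paths K,
       init = [init K],
       edges = {(\<rho>, \<rho> @ [s]) | \<rho> s. \<rho> \<in> finite_initial_paths K \<and> (last \<rho>, s) \<in> edges K},
       label = (\<lambda>\<rho>. label K (last \<rho>)) \<rparr>"

definition kripke_isomorphic :: "('s, 'p) kripke \<Rightarrow> ('t, 'p) kripke \<Rightarrow> bool" where
  "kripke_isomorphic K K' \<longleftrightarrow>
     (\<exists>f. bij_betw f (states K) (states K') \<and>
          f (init K) = init K' \<and>
          (\<forall>s\<in>states K. \<forall>t\<in>states K. (s, t) \<in> edges K \<longleftrightarrow> (f s, f t) \<in> edges K') \<and>
          (\<forall>s\<in>states K. label K s = label K' (f s)))"

text \<open>The nodes of an unwinding are finite paths and those of a tree structure are words over the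
  natural numbers, so the two are identified up to isomorphism. Natural numbers suffice as the
  states of the finite structure.\<close>

definition regular_tree :: "'p set \<Rightarrow> (nat list, 'p) kripke \<Rightarrow> bool" where
  "regular_tree AP T \<longleftrightarrow>
     tree_structure AP T \<and>
     (\<exists>F :: (nat, 'p) kripke. kripke_structure AP F \<and> finite (states F) \<and>
        kripke_isomorphic T (unwinding F))"

definition visits :: "('s, 'p) kripke \<Rightarrow> 's \<Rightarrow> 's word \<Rightarrow> bool" where
  "visits K x \<pi> \<longleftrightarrow> initial_path K \<pi> \<and> x \<in> range \<pi>"

definition path_of :: "('s, 'p) kripke \<Rightarrow> 's \<Rightarrow> 's word" where
  "path_of K x = (THE \<pi>. visits K x \<pi>)"

text \<open>The parameters \<open>l\<close>, \<open>\<eta>\<close>, \<open>\<xi>\<close> and \<open>w\<close> are the length, the successors of the root and the words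
  that witness the required shape of the tree \<open>K\<close>.\<close>

definition K_tree ::
  "'p \<Rightarrow> nat \<Rightarrow> nat \<Rightarrow> nat list \<Rightarrow> (nat \<Rightarrow> nat list) \<Rightarrow> (nat \<Rightarrow> 'p set list)
     \<Rightarrow> (nat list, 'p) kripke \<Rightarrow> bool"
where
  "K_tree p n l \<eta> \<xi> w K \<longleftrightarrow>
     regular_tree {p} K \<and>
     l > 1 \<and>
     label K (init K) = {p} \<and>
     {s. (init K, s) \<in> edges K} = insert \<eta> (\<xi> ` {1..2 * n}) \<and>
     inj_on \<xi> {1..2 * n} \<and> \<eta> \<notin> \<xi> ` {1..2 * n} \<and>
     (\<exists>!\<pi>. visits K \<eta> \<pi>) \<and>
     (\<forall>k\<in>{1..2 * n}. \<exists>!\<pi>. visits K (\<xi> k) \<pi>) \<and>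
     (\<forall>k\<in>{0..2 * n}. length (w k) = l \<and> set (w k) \<subseteq> Pow {p}) \<and>
     inj_on w {0..2 * n} \<and>
     w 0 = replicate l {p} \<and>
     w n ! (l - 1) = {} \<and>
     w (n - 1) ! (l - 1) = {p} \<and>
     trace K (path_of K \<eta>) =
       ([{p}] @ w 0 @ replicate n {} @ replicate n {p}) \<frown> (\<lambda>_. {p}) \<and>
     (\<forall>k\<in>{1..2 * n}. trace K (path_of K (\<xi> k)) =
       ([{p}] @ w k @ replicate (2 * n - k) {} @ replicate k {p}) \<frown> (\<lambda>_. {p}))"

definition M_tree ::
  "nat \<Rightarrow> nat \<Rightarrow> (nat \<Rightarrow> nat list) \<Rightarrow> (nat list, 'p) kripke \<Rightarrow> (nat list, 'p) kripke"
where
  "M_tree n l \<xi> K = K\<lparr>label := (label K)(path_of K (\<xi> n) (l + 1 + n) := {})\<rparr>"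

end

theory Submission
  imports Defs
begin

text \<open>
  From position \<open>l + 1\<close> on, the history of a path identifies it among the finitely many initial
  paths, so an agent who sees \<open>p\<close> knows the path, while a blind agent only knows the position. The
  truth of a formula therefore depends only on the number \<open>r\<close> of labels \<open>{}\<close> still to come on
  the current path and on the maximum \<open>r + g\<close> of that number over all paths. A formula of length
  \<open>s\<close> cannot distinguish values of \<open>r\<close> above \<open>s\<close>, nor values of \<open>g\<close> above \<open>s\<close>. A
  knowledge modality may examine \<open>r\<close> and \<open>g\<close> at the same time, but a balanced formula has to
  spend disjoint parts of its length on the two. The changed label turns \<open>(n, n - 1)\<close> into
  \<open>(n + 1, n - 2)\<close> on the path through \<open>\<xi> n\<close>, which is therefore invisible at position \<open>l + 1\<close>,
  and hence at all earlier ones.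
\<close>

section \<open>Predicates on pairs that are stable above a threshold\<close>

text \<open>One step shortens the remaining \<open>{}\<close> block of every path by one, cut off at
  0. So \<open>r\<close> drops while it is positive; once \<open>r = 0\<close>, the maximum
  \<open>r + g\<close> still drops and the loss falls on \<open>g\<close>. After \<open>d\<close>
  steps the pair is \<open>(r - d, g - (d - r))\<close>.\<close>

definition next_pred :: "(nat \<Rightarrow> nat \<Rightarrow> bool) \<Rightarrow> nat \<Rightarrow> nat \<Rightarrow> bool" where
  "next_pred f r g = f (r - 1) (g - (1 - r))"

definition until_pred ::
  "(nat \<Rightarrow> nat \<Rightarrow> bool) \<Rightarrow> (nat \<Rightarrow> nat \<Rightarrow> bool) \<Rightarrow> nat \<Rightarrow> nat \<Rightarrow> bool"
where
  "until_pred f h r g \<longleftrightarrow> (\<exists>d. h (r - d) (g - (d - r)) \<and> (\<forall>e<d. f (r - e) (g - (e - r))))"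

text \<open>A blind agent considers all paths possible, and the position fixes \<open>r + g\<close>;
  what remains is a whole diagonal of pairs.\<close>

definition everywhere_pred :: "(nat \<Rightarrow> nat \<Rightarrow> bool) \<Rightarrow> nat \<Rightarrow> nat \<Rightarrow> bool" where
  "everywhere_pred f r g \<longleftrightarrow> (\<forall>r'\<le>r + g. f r' (r + g - r'))"

lemma next_pred_simps [simp]:
  "next_pred f (Suc r) g = f r g"
  "next_pred f 0 g = f 0 (g - 1)"
  by (simp_all add: next_pred_def)

lemma until_pred_unfold:
  "until_pred f h r g \<longleftrightarrow> h r g \<or> f r g \<and> until_pred f h (r - 1) (g - (1 - r))"
proof -
  have shift: "r - 1 - d = r - Suc d" "g - (1 - r) - (d - (r - 1)) = g - (Suc d - r)" for d
    by auto
  have "(\<exists>d. Q d) \<longleftrightarrow> Q 0 \<or> (\<exists>d. Q (Suc d))" for Q :: "nat \<Rightarrow> bool"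
    by (metis not0_implies_Suc)
  from this[of "\<lambda>d. h (r - d) (g - (d - r)) \<and> (\<forall>e<d. f (r - e) (g - (e - r)))"]
  show ?thesis
    unfolding until_pred_def shift by (auto simp: All_less_Suc2)
qed

text \<open>The pair \<open>(Suc r, g)\<close> steps to \<open>(r, g)\<close>. If \<open>f\<close>
  and \<open>h\<close> have the same values on both, this step is a stuttering, which an until
  cannot detect.\<close>

lemma until_pred_Suc_left:
  assumes "f r g = f (Suc r) g" and "h r g = h (Suc r) g"
  shows "until_pred f h r g = until_pred f h (Suc r) g"
  using assms until_pred_unfold[of f h "Suc r" g] until_pred_unfold[of f h r g] by auto

text \<open>Both runs meet equal values until \<open>r\<close> reaches 0; there the step from
  \<open>(0, Suc g)\<close> to \<open>(0, g)\<close> is a stuttering.\<close>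

lemma until_pred_Suc_right:
  assumes "\<And>r'. r' \<le> r \<Longrightarrow> f r' g = f r' (Suc g)" and "\<And>r'. r' \<le> r \<Longrightarrow> h r' g = h r' (Suc g)"
  shows "until_pred f h r g = until_pred f h r (Suc g)"
  using assms
proof (induction r)
  case 0
  then show ?case
    using until_pred_unfold[of f h 0 "Suc g"] until_pred_unfold[of f h 0 g] by auto
next
  case (Suc r)
  then show ?case
    using until_pred_unfold[of f h "Suc r" "Suc g"] until_pred_unfold[of f h "Suc r" g] by auto
qed

text \<open>The disjunctions in the last two clauses make \<^const>\<open>everywhere_pred\<close> depend on its sum only
  up to the same threshold, although both coordinates together could reach twice that value.\<close>

definition stable :: "nat \<Rightarrow> (nat \<Rightarrow> nat \<Rightarrow> bool) \<Rightarrow> bool" where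
  "stable s f \<longleftrightarrow>
     (\<forall>r g. s \<le> r \<longrightarrow> f r g = f (Suc r) g) \<and>
     (\<forall>r g. s \<le> Suc g \<longrightarrow> f r g = f r (Suc g)) \<and>
     (\<forall>r g. s \<le> r + g \<longrightarrow> f r g = f (Suc r) g \<or> f r g = f r (Suc g)) \<and>
     (\<forall>r g. s < r + g \<longrightarrow>
        (\<exists>r'. r = Suc r' \<and> f r' g = f r g) \<or> (\<exists>g'. g = Suc g' \<and> f r g' = f r g))"

lemma stableI:
  assumes "\<And>r g. s \<le> r \<Longrightarrow> f r g = f (Suc r) g"
    and "\<And>r g. s \<le> Suc g \<Longrightarrow> f r g = f r (Suc g)"
    and "\<And>r g. \<lbrakk>s \<le> r + g; f r g \<noteq> f (Suc r) g; f r g \<noteq> f r (Suc g)\<rbrakk> \<Longrightarrow> False"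
    and "\<And>r g. \<lbrakk>s < r + g; \<And>r'. r = Suc r' \<Longrightarrow> f r' g \<noteq> f r g;
            \<And>g'. g = Suc g' \<Longrightarrow> f r g' \<noteq> f r g\<rbrakk> \<Longrightarrow> False"
  shows "stable s f"
  unfolding stable_def using assms by blast

lemma stable_left: "stable s f \<Longrightarrow> s \<le> r \<Longrightarrow> f r g = f (Suc r) g"
  and stable_right: "stable s f \<Longrightarrow> s \<le> Suc g \<Longrightarrow> f r g = f r (Suc g)"
  and stable_up: "stable s f \<Longrightarrow> s \<le> r + g \<Longrightarrow> f r g = f (Suc r) g \<or> f r g = f r (Suc g)"
  and stable_down: "stable s f \<Longrightarrow> s < r + g \<Longrightarrow>
    (\<exists>r'. r = Suc r' \<and> f r' g = f r g) \<or> (\<exists>g'. g = Suc g' \<and> f r g' = f r g)"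
  unfolding stable_def by blast+

section \<open>Stability under the connectives and modalities\<close>

lemma stable_mono:
  assumes "stable s f" and "s \<le> t"
  shows "stable t f"
  using assms unfolding stable_def by (meson le_less_trans le_trans)

lemma stable_not: "stable s f \<Longrightarrow> stable s (\<lambda>r g. \<not> f r g)"
  unfolding stable_def Not_eq_iff .

text \<open>If the disjunction changes in both directions, then, since each disjunct is constant in
  one of them, one disjunct reacts to \<open>r\<close> and the other to \<open>g\<close>. The first
  bounds \<open>r\<close> by its own threshold and the second bounds \<open>g\<close> by its own, so
  the sum is at most \<open>s + t\<close>. This is how disjoint parts of the length pay for the two
  coordinates.\<close>

lemma stable_or:
  assumes f: "stable s f" and h: "stable t h"
  shows "stable (s + t) (\<lambda>r g. f r g \<or> h r g)"
proof (rule stableI)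
  fix r g
  show "(f r g \<or> h r g) = (f (Suc r) g \<or> h (Suc r) g)" if "s + t \<le> r"
    using that stable_left[OF f, of r g] stable_left[OF h, of r g] by simp
  show "(f r g \<or> h r g) = (f r (Suc g) \<or> h r (Suc g))" if "s + t \<le> Suc g"
    using that stable_right[OF f, of g r] stable_right[OF h, of g r] by simp
  show False
    if "s + t \<le> r + g" and "(f r g \<or> h r g) \<noteq> (f (Suc r) g \<or> h (Suc r) g)"
      and "(f r g \<or> h r g) \<noteq> (f r (Suc g) \<or> h r (Suc g))"
  proof -
    have "f r g \<noteq> f (Suc r) g \<or> h r g \<noteq> h (Suc r) g" "f r g \<noteq> f r (Suc g) \<or> h r g \<noteq> h r (Suc g)"
      using that by auto
    moreover have "f r g = f (Suc r) g \<or> f r g = f r (Suc g)" "h r g = h (Suc r) g \<or> h r g = h r (Suc g)"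
      using that stable_up[OF f, of r g] stable_up[OF h, of r g] by auto
    moreover have "r < s" if "f r g \<noteq> f (Suc r) g"
      using that stable_left[OF f, of r g] by (cases "s \<le> r") auto
    moreover have "r < t" if "h r g \<noteq> h (Suc r) g"
      using that stable_left[OF h, of r g] by (cases "t \<le> r") auto
    moreover have "g < s" if "f r g \<noteq> f r (Suc g)"
      using that stable_right[OF f, of g r] by (cases "s \<le> Suc g") auto
    moreover have "g < t" if "h r g \<noteq> h r (Suc g)"
      using that stable_right[OF h, of g r] by (cases "t \<le> Suc g") auto
    ultimately have "r < s \<and> g < t \<or> r < t \<and> g < s"
      by blast
    then show False using that(1) by auto
  qed
  show False
    if sum: "s + t < r + g"
      and r: "\<And>r'. r = Suc r' \<Longrightarrow> (f r' g \<or> h r' g) \<noteq> (f r g \<or> h r g)"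
      and g: "\<And>g'. g = Suc g' \<Longrightarrow> (f r g' \<or> h r g') \<noteq> (f r g \<or> h r g)"
  \<comment> \<open>The same count downwards; on an axis only one coordinate can be lowered, and it
    alone exceeds both thresholds.\<close>
  proof (cases r)
    case 0
    with sum obtain g' where "g = Suc g'" by (cases g) auto
    then show False
      using 0 sum g[of g'] stable_right[OF f, of g' r] stable_right[OF h, of g' r] by auto
  next
    case (Suc r')
    show False
    proof (cases g)
      case 0
      then show False
        using Suc sum r[of r'] stable_left[OF f, of r' g] stable_left[OF h, of r' g] by auto
    next
      case g': (Suc g')
      have "f r' g \<noteq> f r g \<or> h r' g \<noteq> h r g" "f r g' \<noteq> f r g \<or> h r g' \<noteq> h r g"
        using r[OF Suc] g[OF g'] by auto
      moreover have "f r' g = f r g \<or> f r g' = f r g" "h r' g = h r g \<or> h r g' = h r g"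
        using stable_down[OF f, of r g] stable_down[OF h, of r g] sum Suc g' by auto
      moreover have "r \<le> s" if "f r' g \<noteq> f r g"
        using that stable_left[OF f, of r' g] Suc by (cases "s \<le> r'") auto
      moreover have "r \<le> t" if "h r' g \<noteq> h r g"
        using that stable_left[OF h, of r' g] Suc by (cases "t \<le> r'") auto
      moreover have "g \<le> s" if "f r g' \<noteq> f r g"
        using that stable_right[OF f, of g' r] g' by (cases "s \<le> g") auto
      moreover have "g \<le> t" if "h r g' \<noteq> h r g"
        using that stable_right[OF h, of g' r] g' by (cases "t \<le> g") auto
      ultimately have "r \<le> s \<and> g \<le> t \<or> r \<le> t \<and> g \<le> s"
        by blast
      then show False using sum by auto
    qed
  qed
qed

text \<open>A step lowers \<open>r\<close>, or \<open>g\<close> when \<open>r = 0\<close>, by at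
  most one, so one extra unit of threshold pays for it.\<close>

lemma stable_next:
  assumes f: "stable s f"
  shows "stable (Suc s) (next_pred f)"
proof (rule stableI)
  fix r g
  show "next_pred f r g = next_pred f (Suc r) g" if "Suc s \<le> r"
    using that stable_left[OF f, of "r - 1" g] by (cases r) auto
  show "next_pred f r g = next_pred f r (Suc g)" if "Suc s \<le> Suc g"
    using that stable_right[OF f, of g "r - 1"] stable_right[OF f, of "g - 1" 0]
    by (cases r; cases g) auto
  show False
    if "Suc s \<le> r + g" "next_pred f r g \<noteq> next_pred f (Suc r) g"
      "next_pred f r g \<noteq> next_pred f r (Suc g)"
    using that stable_up[OF f, of "r - 1" g] stable_right[OF f, of "g - 1" 0]
    by (cases r; cases g) auto
  show False
    if "Suc s < r + g"
      and "\<And>r'. r = Suc r' \<Longrightarrow> next_pred f r' g \<noteq> next_pred f r g"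
      and "\<And>g'. g = Suc g' \<Longrightarrow> next_pred f r g' \<noteq> next_pred f r g"
  proof (cases r)
    case 0
    then show False
      using that(1) that(3)[of "g - 1"] stable_right[OF f, of "g - 2" 0]
      by (cases g; cases "g - 1") auto
  next
    case r: (Suc r')
    show False
    proof (cases r')
      case 0
      then show False
        using r that(1) that(3)[of "g - 1"] stable_right[OF f, of "g - 1" 0] by simp
    next
      case (Suc r'')
      then show False
        using r that(1) that(2)[of r'] that(3)[of "g - 1"] stable_down[OF f, of r' g] by auto
    qed
  qed
qed

text \<open>By stuttering, the until keeps the threshold \<open>s\<close> in each coordinate
  separately. The doubling serves the clauses about sums: beyond \<open>2 * s\<close>, one of the
  coordinates is beyond \<open>s\<close>.\<close>

lemma stable_until:
  assumes f: "stable s f" and h: "stable s h"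
  shows "stable (2 * s) (until_pred f h)"
proof (rule stableI)
  let ?u = "until_pred f h"
  have left: "?u r g = ?u (Suc r) g" if "s \<le> r" for r g
    by (rule until_pred_Suc_left[OF stable_left[OF f that] stable_left[OF h that]])
  have right: "?u r g = ?u r (Suc g)" if "s \<le> Suc g" for r g
    by (rule until_pred_Suc_right[OF stable_right[OF f that] stable_right[OF h that]])
  fix r g
  show "?u r g = ?u (Suc r) g" if "2 * s \<le> r"
    using that by (intro left) simp
  show "?u r g = ?u r (Suc g)" if "2 * s \<le> Suc g"
    using that by (intro right) simp
  show False if "2 * s \<le> r + g" "?u r g \<noteq> ?u (Suc r) g" "?u r g \<noteq> ?u r (Suc g)"
    using that left[of r g] right[of g r] by linarith
  show False
    if "2 * s < r + g" "\<And>r'. r = Suc r' \<Longrightarrow> ?u r' g \<noteq> ?u r g"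
      "\<And>g'. g = Suc g' \<Longrightarrow> ?u r g' \<noteq> ?u r g"
  proof (cases "s < r")
    case True
    then show False using that(2)[of "r - 1"] left[of "r - 1" g] by (cases r) auto
  next
    case False
    with that(1) have "s < g" by simp
    then show False using that(3)[of "g - 1"] right[of "g - 1" r] by (cases g) auto
  qed
qed

text \<open>Two neighbouring diagonals carry the same truth values: \<open>stable_down\<close> takes
  each pair of the upper one to a pair of the lower one with equal value, and
  \<open>stable_up\<close> goes back.\<close>

lemma everywhere_pred_Suc:
  assumes f: "stable s f" and "s \<le> r + g" and sum: "r' + g' = Suc (r + g)"
  shows "everywhere_pred f r g = everywhere_pred f r' g'"
proof -
  have pairs: "everywhere_pred f r g \<longleftrightarrow> (\<forall>a b. a + b = r + g \<longrightarrow> f a b)" for r g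
    unfolding everywhere_pred_def by (metis le_add1 add_diff_cancel_left' le_add_diff_inverse)
  show ?thesis
  proof
    assume low: "everywhere_pred f r g"
    show "everywhere_pred f r' g'"
      unfolding pairs sum
    proof (intro allI impI)
      fix a b assume "a + b = Suc (r + g)"
      then show "f a b"
        using stable_down[OF f, of a b] low assms(2) unfolding pairs by auto
    qed
  next
    assume high: "everywhere_pred f r' g'"
    show "everywhere_pred f r g"
      unfolding pairs
    proof (intro allI impI)
      fix a b assume "a + b = r + g"
      then show "f a b"
        using stable_up[OF f, of a b] high assms(2) unfolding pairs sum by auto
    qed
  qed
qed

text \<open>The value depends on \<open>r + g\<close> only, so every clause compares two
  neighbouring diagonals.\<close>

lemma stable_everywhere:
  assumes f: "stable s f"
  shows "stable (Suc s) (everywhere_pred f)"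
proof (rule stableI)
  let ?e = "everywhere_pred f"
  fix r g
  show "?e r g = ?e (Suc r) g" if "Suc s \<le> r"
    using that by (intro everywhere_pred_Suc[OF f]) auto
  show "?e r g = ?e r (Suc g)" if "Suc s \<le> Suc g"
    using that by (intro everywhere_pred_Suc[OF f]) auto
  show False if "Suc s \<le> r + g" "?e r g \<noteq> ?e (Suc r) g"
    using that everywhere_pred_Suc[OF f, of r g "Suc r" g] by simp
  show False
    if "Suc s < r + g" "\<And>r'. r = Suc r' \<Longrightarrow> ?e r' g \<noteq> ?e r g"
      "\<And>g'. g = Suc g' \<Longrightarrow> ?e r g' \<noteq> ?e r g"
    using that(1) that(2)[of "r - 1"] that(3)[of "g - 1"]
      everywhere_pred_Suc[OF f, of "r - 1" g r g] everywhere_pred_Suc[OF f, of r "g - 1" r g]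
    by (cases r; cases g) auto
qed

section \<open>Truth of formulas behind the distinguishing words\<close>

primrec tail_sat :: "'p \<Rightarrow> ('a \<Rightarrow> 'p set) \<Rightarrow> ('p, 'a) kctl \<Rightarrow> nat \<Rightarrow> nat \<Rightarrow> bool" where
  "tail_sat p Obs Top = (\<lambda>r g. True)"
| "tail_sat p Obs (Atom q) = (\<lambda>r g. q = p \<and> r = 0)"
| "tail_sat p Obs (Neg \<phi>) = (\<lambda>r g. \<not> tail_sat p Obs \<phi> r g)"
| "tail_sat p Obs (Or \<phi>\<^sub>1 \<phi>\<^sub>2) = (\<lambda>r g. tail_sat p Obs \<phi>\<^sub>1 r g \<or> tail_sat p Obs \<phi>\<^sub>2 r g)"
| "tail_sat p Obs (Next \<phi>) = next_pred (tail_sat p Obs \<phi>)"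
| "tail_sat p Obs (Until \<phi>\<^sub>1 \<phi>\<^sub>2) = until_pred (tail_sat p Obs \<phi>\<^sub>1) (tail_sat p Obs \<phi>\<^sub>2)"
| "tail_sat p Obs (Exists \<phi>) = tail_sat p Obs \<phi>"
| "tail_sat p Obs (Knows a \<phi>) =
     (if p \<in> Obs a then tail_sat p Obs \<phi> else everywhere_pred (tail_sat p Obs \<phi>))"

lemma balanced_simps:
  "balanced (Neg \<phi>) \<longleftrightarrow> balanced \<phi>"
  "balanced (Or \<phi>\<^sub>1 \<phi>\<^sub>2) \<longleftrightarrow> balanced \<phi>\<^sub>1 \<and> balanced \<phi>\<^sub>2"
  "balanced (Next \<phi>) \<longleftrightarrow> balanced \<phi>"
  "balanced (Until \<phi>\<^sub>1 \<phi>\<^sub>2) \<longleftrightarrow> len \<phi>\<^sub>1 = len \<phi>\<^sub>2 \<and> balanced \<phi>\<^sub>1 \<and> balanced \<phi>\<^sub>2"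
  "balanced (Exists \<phi>) \<longleftrightarrow> balanced \<phi>"
  "balanced (Knows a \<phi>) \<longleftrightarrow> balanced \<phi>"
  unfolding balanced_def by auto

lemma stable_tail_sat: "balanced \<phi> \<Longrightarrow> stable (len \<phi>) (tail_sat p Obs \<phi>)"
proof (induction \<phi>)
  case Top
  then show ?case by (simp add: stable_def) presburger
next
  case (Atom q)
  show ?case
  proof (rule stableI)
    fix r g
    assume "len (Atom q) < r + g"
      and "\<And>r'. r = Suc r' \<Longrightarrow> tail_sat p Obs (Atom q) r' g \<noteq> tail_sat p Obs (Atom q) r g"
      and "\<And>g'. g = Suc g' \<Longrightarrow> tail_sat p Obs (Atom q) r g' \<noteq> tail_sat p Obs (Atom q) r g"
    then show False by (cases g; cases r) auto
  qed auto
next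
  case (Neg \<phi>)
  then show ?case
    by (auto simp: balanced_simps intro: stable_not stable_mono)
next
  case (Or \<phi>\<^sub>1 \<phi>\<^sub>2)
  then have "stable (len \<phi>\<^sub>1 + len \<phi>\<^sub>2) (tail_sat p Obs (Or \<phi>\<^sub>1 \<phi>\<^sub>2))"
    by (auto simp: balanced_simps intro: stable_or)
  then show ?case by (rule stable_mono) simp
next
  case (Next \<phi>)
  then show ?case by (auto simp: balanced_simps intro: stable_next)
next
  case (Until \<phi>\<^sub>1 \<phi>\<^sub>2)
  \<comment> \<open>Balance enters here: equal lengths of the arguments make
    \<open>2 * len \<phi>\<^sub>1\<close> their total length, which is below the length of the
    until.\<close>
  then have "stable (2 * len \<phi>\<^sub>1) (tail_sat p Obs (Until \<phi>\<^sub>1 \<phi>\<^sub>2))"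
    by (auto simp: balanced_simps intro: stable_until)
  then show ?case using Until.prems by (auto simp: balanced_simps intro: stable_mono)
next
  case (Exists \<phi>)
  then show ?case by (auto simp: balanced_simps intro: stable_mono)
next
  case (Knows a \<phi>)
  then show ?case by (auto simp: balanced_simps intro: stable_everywhere stable_mono)
qed

text \<open>Stated for an arbitrary family of paths so that it serves both trees, which differ only
  in \<open>m\<close>. The map \<open>m\<close> may repeat values, since paths are told apart by
  their labels before \<open>b\<close>; a blind agent needs only the set of values, and
  \<open>range\<close> makes it a full initial segment.\<close>

lemma sat_iff_tail_sat:
  fixes K :: "('s, 'p) kripke"
  assumes paths: "\<And>\<pi>. initial_path K \<pi> \<longleftrightarrow> \<pi> \<in> P ` I"
    and tail: "\<And>k j. k \<in> I \<Longrightarrow> label K (P k (b + j)) = (if j < m k then {} else {p})"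
    and prefix: "\<And>k j. k \<in> I \<Longrightarrow> j < b \<Longrightarrow> label K (P k j) \<subseteq> {p}"
    and distinct: "\<And>k k'. \<lbrakk>k \<in> I; k' \<in> I; \<And>j. j < b \<Longrightarrow> label K (P k j) = label K (P k' j)\<rbrakk> \<Longrightarrow> k = k'"
    and range: "m ` I = {..N}"
    and "k \<in> I"
  shows "sat K Obs \<phi> (P k) (b + j) = tail_sat p Obs \<phi> (m k - j) (N - j - (m k - j))"
  using \<open>k \<in> I\<close>
proof (induction \<phi> arbitrary: k j)
  case (Atom q)
  then show ?case by (simp add: tail)
next
  case (Next \<phi>)
  have "m k \<le> N" using range Next.prems by auto
  then have "m k - j - 1 = m k - Suc j"
    "N - j - (m k - j) - (1 - (m k - j)) = N - Suc j - (m k - Suc j)"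
    by auto
  then show ?case
    using Next.IH[OF Next.prems, of "Suc j"] by (simp add: next_pred_def)
next
  case (Until \<phi>\<^sub>1 \<phi>\<^sub>2)
  have "m k \<le> N" using range Until.prems by auto
  then have shift: "m k - j - d = m k - (j + d)"
    "N - j - (m k - j) - (d - (m k - j)) = N - (j + d) - (m k - (j + d))" for d
    by auto
  have "sat K Obs (Until \<phi>\<^sub>1 \<phi>\<^sub>2) (P k) (b + j) \<longleftrightarrow>
      (\<exists>d. sat K Obs \<phi>\<^sub>2 (P k) (b + (j + d)) \<and> (\<forall>e<d. sat K Obs \<phi>\<^sub>1 (P k) (b + (j + e))))"
    (is "?l \<longleftrightarrow> ?r")
  proof
    assume ?l
    then obtain i where "i \<ge> b + j" "sat K Obs \<phi>\<^sub>2 (P k) i"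
      "\<forall>e. b + j \<le> e \<and> e < i \<longrightarrow> sat K Obs \<phi>\<^sub>1 (P k) e"
      by auto
    then show ?r by (intro exI[of _ "i - (b + j)"]) auto
  next
    assume ?r
    then obtain d where d: "sat K Obs \<phi>\<^sub>2 (P k) (b + (j + d))"
      "\<And>e. e < d \<Longrightarrow> sat K Obs \<phi>\<^sub>1 (P k) (b + (j + e))"
      by auto
    have "sat K Obs \<phi>\<^sub>1 (P k) e" if "b + j \<le> e" "e < b + (j + d)" for e
      using that d(2)[of "e - (b + j)"] by simp
    then show ?l using d(1) by (auto intro!: exI[of _ "b + (j + d)"])
  qed
  then show ?case
    using Until.IH Until.prems by (simp add: until_pred_def shift del: sat.simps diff_diff_left)
next
  case (Exists \<phi>)
  \<comment> \<open>At positions from \<open>b\<close> on, a common history includes the labels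
    before \<open>b\<close>, so no branching is left.\<close>
  have "k' = k" if "k' \<in> I" "\<forall>i\<le>b + j. P k' i = P k i" for k'
    using that Exists.prems distinct[of k' k] by simp
  then have "sat K Obs (Exists \<phi>) (P k) (b + j) = sat K Obs \<phi> (P k) (b + j)"
    using Exists.prems by (auto simp: paths)
  then show ?case using Exists by simp
next
  case (Knows a \<phi>)
  have sub: "label K (P k i) \<subseteq> {p}" if "k \<in> I" for k i
    using that prefix[of k i] tail[of k "i - b"] by (cases "i < b") auto
  show ?case
  proof (cases "p \<in> Obs a")
    case True
    have "k' = k" if "k' \<in> I" "\<forall>i\<le>b + j. label K (P k' i) \<inter> Obs a = label K (P k i) \<inter> Obs a" for k'
    proof (rule distinct)
      fix i assume "i < b"
      then have "label K (P k' i) \<inter> Obs a = label K (P k i) \<inter> Obs a" using that by simp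
      then show "label K (P k' i) = label K (P k i)"
        using True sub[OF that(1), of i] sub[OF Knows.prems, of i] by blast
    qed (use that Knows.prems in auto)
    then have "sat K Obs (Knows a \<phi>) (P k) (b + j) = sat K Obs \<phi> (P k) (b + j)"
      using Knows.prems by (auto simp: paths)
    then show ?thesis using True Knows by simp
  next
    case False
    have "label K (P k' i) \<inter> Obs a = {}" if "k' \<in> I" for k' i
      using False sub[OF that, of i] by blast
    then have "sat K Obs (Knows a \<phi>) (P k) (b + j) \<longleftrightarrow> (\<forall>k'\<in>I. sat K Obs \<phi> (P k') (b + j))"
      using Knows.prems by (auto simp: paths)
    also have "\<dots> \<longleftrightarrow> (\<forall>k'\<in>I. tail_sat p Obs \<phi> (m k' - j) (N - j - (m k' - j)))"
      using Knows.IH by simp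
    also have "\<dots> \<longleftrightarrow> (\<forall>r\<in>(\<lambda>x. x - j) ` m ` I. tail_sat p Obs \<phi> r (N - j - r))"
      by simp
    also have "(\<lambda>x. x - j) ` m ` I = {..N - j}"
    proof -
      \<comment> \<open>For \<open>r = 0\<close> the witness is 0 because \<open>r + j\<close> may
        exceed \<open>N\<close>; a positive \<open>r\<close> forces
        \<open>r + j \<le> N\<close>.\<close>
      have "r \<in> (\<lambda>x. x - j) ` {..N}" if "r \<le> N - j" for r
        using that by (cases "r = 0") (auto intro: image_eqI[of _ _ "r + j"] image_eqI[of _ _ 0])
      then show ?thesis unfolding range by auto
    qed
    also have "(\<forall>r\<in>{..N - j}. tail_sat p Obs \<phi> r (N - j - r)) \<longleftrightarrow>
        everywhere_pred (tail_sat p Obs \<phi>) (m k - j) (N - j - (m k - j))"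
    proof -
      have "m k \<le> N" using range Knows.prems by auto
      then have "m k - j + (N - j - (m k - j)) = N - j" by simp
      then show ?thesis by (simp only: everywhere_pred_def) auto
    qed
    finally show ?thesis using False by simp
  qed
qed simp_all

section \<open>The two trees\<close>

lemma tree_initial_path_step:
  assumes "tree_structure AP T" and "initial_path T \<pi>"
  obtains x where "\<pi> (Suc i) = \<pi> i @ [x]"
  using assms unfolding tree_structure_def initial_path_def by blast

lemma tree_initial_path_length:
  assumes "tree_structure AP T" and "initial_path T \<pi>"
  shows "length (\<pi> i) = i"
proof (induction i)
  case 0
  then show ?case using assms unfolding tree_structure_def initial_path_def by simp
next
  case (Suc i)
  obtain x where "\<pi> (Suc i) = \<pi> i @ [x]" using tree_initial_path_step[OF assms] .
  then show ?case using Suc by simp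
qed

text \<open>A node contains the whole path leading to it; this later confines a relabelled node to a
  single initial path.\<close>

lemma tree_initial_path_take:
  assumes "tree_structure AP T" and "initial_path T \<pi>" and "j \<le> i"
  shows "\<pi> j = take j (\<pi> i)"
  using \<open>j \<le> i\<close>
proof (induction i rule: dec_induct)
  case base
  then show ?case using tree_initial_path_length[OF assms(1,2)] by simp
next
  case (step i)
  obtain x where "\<pi> (Suc i) = \<pi> i @ [x]" using tree_initial_path_step[OF assms(1,2)] .
  then show ?case using step tree_initial_path_length[OF assms(1,2), of i] by simp
qed

section \<open>From the end of the distinguishing words back to the root\<close>

lemma sat_until_unfold:
  "sat K Obs (Until \<phi>\<^sub>1 \<phi>\<^sub>2) \<pi> i \<longleftrightarrow>
     sat K Obs \<phi>\<^sub>2 \<pi> i \<or> sat K Obs \<phi>\<^sub>1 \<pi> i \<and> sat K Obs (Until \<phi>\<^sub>1 \<phi>\<^sub>2) \<pi> (Suc i)"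
  (is "?l \<longleftrightarrow> ?r")
proof
  assume ?l
  then obtain j where "j \<ge> i" "sat K Obs \<phi>\<^sub>2 \<pi> j" "\<forall>k. i \<le> k \<and> k < j \<longrightarrow> sat K Obs \<phi>\<^sub>1 \<pi> k"
    by auto
  then show ?r by (cases "j = i") (auto intro!: exI[of _ j])
next
  assume ?r
  then show ?l
  proof
    assume "sat K Obs \<phi>\<^sub>2 \<pi> i"
    then show ?l by (auto intro!: exI[of _ i])
  next
    assume later: "sat K Obs \<phi>\<^sub>1 \<pi> i \<and> sat K Obs (Until \<phi>\<^sub>1 \<phi>\<^sub>2) \<pi> (Suc i)"
    then obtain j where j: "j \<ge> Suc i" "sat K Obs \<phi>\<^sub>2 \<pi> j"
      "\<forall>k. Suc i \<le> k \<and> k < j \<longrightarrow> sat K Obs \<phi>\<^sub>1 \<pi> k"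
      by auto
    have "sat K Obs \<phi>\<^sub>1 \<pi> k" if "i \<le> k" "k < j" for k
      using that j(3) later by (cases "k = i") auto
    then show ?l using j by (auto intro!: exI[of _ j])
  qed
qed

text \<open>Before \<open>b\<close> the two structures have equal labels and equal paths, hence
  equal indistinguishability relations. At \<open>b\<close> itself, atoms and the temporal and
  knowledge modalities are settled by \<open>tails\<close>.\<close>

lemma sat_eq_before:
  assumes paths: "\<And>\<pi>. initial_path M \<pi> = initial_path K \<pi>"
    and labels: "\<And>\<pi> i. \<lbrakk>initial_path K \<pi>; i < b\<rbrakk> \<Longrightarrow> label M (\<pi> i) = label K (\<pi> i)"
    and tails: "\<And>\<phi> \<pi>. \<lbrakk>balanced \<phi>; len \<phi> < n; initial_path K \<pi>\<rbrakk> \<Longrightarrow>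
      sat M Obs \<phi> \<pi> b = sat K Obs \<phi> \<pi> b"
    and "balanced \<phi>" and "len \<phi> < n" and "initial_path K \<pi>" and "i \<le> b"
  shows "sat M Obs \<phi> \<pi> i = sat K Obs \<phi> \<pi> i"
  using assms(4-)
proof (induction \<phi> arbitrary: \<pi> i)
  case (Atom q)
  then show ?case using tails[of "Atom q" \<pi>] labels by (cases "i = b") auto
next
  case (Next \<phi>)
  then show ?case
    using tails[of "Next \<phi>" \<pi>] by (cases "i = b") (auto simp: balanced_simps)
next
  case (Until \<phi>\<^sub>1 \<phi>\<^sub>2)
  \<comment> \<open>Backward induction from \<open>b\<close>, with the expansion law of the until as
    the step.\<close>
  from \<open>i \<le> b\<close> show ?case
  proof (induction i rule: inc_induct)
    case base
    then show ?case using Until.prems tails by blast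
  next
    case (step i)
    have "sat M Obs \<phi>\<^sub>1 \<pi> i = sat K Obs \<phi>\<^sub>1 \<pi> i" "sat M Obs \<phi>\<^sub>2 \<pi> i = sat K Obs \<phi>\<^sub>2 \<pi> i"
      using Until step by (auto simp: balanced_simps)
    then show ?case
      using step.IH by (subst (1 2) sat_until_unfold) simp
  qed
next
  case (Exists \<phi>)
  then show ?case by (auto simp: balanced_simps paths)
next
  case (Knows a \<phi>)
  show ?case
  proof (cases "i = b")
    case True
    then show ?thesis using tails Knows.prems by blast
  next
    case False
    then have "label M (\<pi>' j) = label K (\<pi>' j)" if "initial_path K \<pi>'" "j \<le> i" for \<pi>' j
      using that Knows.prems labels by simp
    then show ?thesis using Knows by (auto simp: balanced_simps paths)
  qed
qed (auto simp: balanced_simps)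

theorem theorem2:
  fixes p :: 'p
    and n l :: nat
    and \<eta> :: "nat list"
    and \<xi> :: "nat \<Rightarrow> nat list"
    and w :: "nat \<Rightarrow> 'p set list"
    and K M :: "(nat list, 'p) kripke"
    and \<psi> :: "('p, 'a) kctl"
    and Agts :: "'a set"
    and Obs :: "'a \<Rightarrow> 'p set"
  assumes "n > 1"
    and "K_tree p n l \<eta> \<xi> w K"
    and "M = M_tree n l \<xi> K"
    and "atoms \<psi> \<subseteq> {p}"
    and "sentence \<psi>" and "balanced \<psi>" and "len \<psi> < n"
    and "finite Agts" and "agents \<psi> \<subseteq> Agts"
    and "\<And>a. a \<in> Agts \<Longrightarrow> Obs a \<subseteq> {p}"
  shows "models K Obs \<psi> \<longleftrightarrow> models M Obs \<psi>"
proof -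
  \<comment> \<open>Treating \<open>\<eta>\<close> as the successor with index 0 lets all
    \<open>2 * n + 1\<close> paths be handled uniformly.\<close>
  define s where "s = \<xi>(0 := \<eta>)"
  define P where "P k = path_of K (s k)" for k
  \<comment> \<open>The number of labels \<open>{}\<close> following the word
    \<open>w k\<close>.\<close>
  define m where "m k = (if k = 0 then n else 2 * n - k)" for k
  define m' where "m' = m(n := Suc n)"
  define I where "I = {0..2 * n}"
  have tree: "tree_structure {p} K"
    and succs: "{x. (init K, x) \<in> edges K} = s ` I"
    and unique: "\<And>k. k \<in> I \<Longrightarrow> \<exists>!\<pi>. visits K (s k) \<pi>"
    and words: "\<And>k. k \<in> I \<Longrightarrow> length (w k) = l \<and> set (w k) \<subseteq> Pow {p}"
    and inj: "inj_on w I"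
    and traces: "\<And>k. k \<in> I \<Longrightarrow> trace K (P k) =
      ([{p}] @ w k @ replicate (m k) {} @ replicate (2 * n - m k) {p}) \<frown> (\<lambda>_. {p})"
  proof -
    have split: "I = insert 0 {1..2 * n}" by (auto simp: I_def)
    show "tree_structure {p} K" "inj_on w I"
      "\<And>k. k \<in> I \<Longrightarrow> length (w k) = l \<and> set (w k) \<subseteq> Pow {p}"
      using assms(2) unfolding K_tree_def regular_tree_def I_def by blast+
    have "s ` {1..2 * n} = \<xi> ` {1..2 * n}" by (auto simp: s_def)
    then show "{x. (init K, x) \<in> edges K} = s ` I"
      using assms(2) unfolding K_tree_def split image_insert by (simp only: s_def fun_upd_same)
    show "\<exists>!\<pi>. visits K (s k) \<pi>" if "k \<in> I" for k
      using assms(2) that unfolding K_tree_def split by (cases "k = 0") (auto simp: s_def)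
    show "trace K (P k) =
        ([{p}] @ w k @ replicate (m k) {} @ replicate (2 * n - m k) {p}) \<frown> (\<lambda>_. {p})"
      if "k \<in> I" for k
    proof (cases "k = 0")
      case True
      then show ?thesis using assms(2) unfolding K_tree_def by (simp add: P_def s_def m_def)
    next
      case False
      then have "k \<in> {1..2 * n}" using that by (auto simp: I_def)
      then show ?thesis using assms(2) unfolding K_tree_def by (simp add: P_def s_def m_def)
    qed
  qed
  have visits_P: "visits K (s k) (P k)" if "k \<in> I" for k
    unfolding P_def path_of_def by (rule theI'[OF unique[OF that]])
  have paths: "initial_path K \<pi> \<longleftrightarrow> \<pi> \<in> P ` I" for \<pi>
  proof
    assume \<pi>: "initial_path K \<pi>"
    \<comment> \<open>The second node of a path is some \<open>s k\<close>, and only one initial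
      path visits it.\<close>
    then have "(init K, \<pi> 1) \<in> edges K" unfolding initial_path_def by (metis One_nat_def)
    then obtain k where "k \<in> I" "\<pi> 1 = s k" using succs by auto
    moreover from this have "visits K (s k) \<pi>" using \<pi> unfolding visits_def by (metis rangeI)
    ultimately show "\<pi> \<in> P ` I" using unique visits_P by blast
  next
    assume "\<pi> \<in> P ` I"
    then show "initial_path K \<pi>" using visits_P unfolding visits_def by auto
  qed
  have paths_M: "initial_path M \<pi> = initial_path K \<pi>" for \<pi>
    by (simp add: assms(3) M_tree_def initial_path_def)
  have head: "label K (P k i) = ({p} # w k) ! i" if "k \<in> I" "i < l + 1" for k i
    using fun_cong[OF traces[OF that(1)], of i] words[OF that(1)] that(2)
    by (auto simp: trace_def conc_def nth_append nth_Cons')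
  have tail: "label K (P k (l + 1 + j)) = (if j < m k then {} else {p})" if "k \<in> I" for k j
    using fun_cong[OF traces[OF that], of "l + 1 + j"] words[OF that]
    by (auto simp: trace_def conc_def nth_append nth_Cons')
  have distinct: "k = k'"
    if "k \<in> I" "k' \<in> I" "\<And>i. i < l + 1 \<Longrightarrow> label K (P k i) = label K (P k' i)" for k k'
  proof -
    have "w k = w k'"
    proof (rule nth_equalityI)
      show "length (w k) = length (w k')" using words that by simp
      show "w k ! i = w k' ! i" if "i < length (w k)" for i
        using that \<open>k \<in> I\<close> \<open>k' \<in> I\<close> words head[of k "Suc i"] head[of k' "Suc i"]
          \<open>\<And>i. i < l + 1 \<Longrightarrow> label K (P k i) = label K (P k' i)\<close>[of "Suc i"] by simp
    qed
    then show ?thesis using inj that by (auto dest: inj_onD)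
  qed
  have prefix: "label K (P k i) \<subseteq> {p}" if "k \<in> I" "i < l + 1" for k i
    using head[OF that] words[OF that(1)] that(2) by (cases i) (auto dest!: nth_mem)
  have "n \<in> I" by (simp add: I_def)
  have "P n = path_of K (\<xi> n)" using assms(1) by (simp add: P_def s_def)
  \<comment> \<open>The depth of the relabelled node fixes the position, and its ancestors fix the
    word and thus the path.\<close>
  have node: "k = n \<and> i = l + 1 + n" if "k \<in> I" "P k i = P n (l + 1 + n)" for k i
  proof -
    have take: "P k j = take j (P k i)" if "k \<in> I" "j \<le> i" for k i j
      using that tree_initial_path_take[OF tree] paths by blast
    have "length (P k i) = i" if "k \<in> I" for k i
      using that tree_initial_path_length[OF tree] paths by blast
    then have i: "i = l + 1 + n" using that \<open>n \<in> I\<close> by metis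
    have "k = n"
    proof (rule distinct)
      fix j assume "j < l + 1"
      then have "P k j = P n j"
        using take[OF \<open>k \<in> I\<close>, of j i] take[OF \<open>n \<in> I\<close>, of j i] that i by simp
      then show "label K (P k j) = label K (P n j)" by simp
    qed (use that \<open>n \<in> I\<close> in auto)
    then show ?thesis using i by simp
  qed
  have label_M: "label M (P k i) = (if k = n \<and> i = l + 1 + n then {} else label K (P k i))"
    if "k \<in> I" for k i
    using node[OF that, of i] \<open>P n = path_of K (\<xi> n)\<close> by (auto simp: assms(3) M_tree_def)
  \<comment> \<open>Offset \<open>n\<close> carries the first \<open>{p}\<close> after the
    \<open>{}\<close> block on the path \<open>P n\<close>, so the relabelling lengthens the block
    by one.\<close>
  have tail_M: "label M (P k (l + 1 + j)) = (if j < m' k then {} else {p})" if "k \<in> I" for k j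
    using tail[OF that] label_M[OF that] assms(1) by (auto simp: m'_def m_def)
  have head_M: "label M (P k i) = label K (P k i)" if "k \<in> I" "i < l + 1" for k i
    using label_M[OF that(1)] that(2) by simp
  have range: "m ` I = {..2 * n - 1}"
  proof -
    have "r \<in> m ` I" if "r \<le> 2 * n - 1" for r
      using that assms(1) by (intro image_eqI[of _ _ "2 * n - r"]) (auto simp: m_def I_def)
    then show ?thesis using assms(1) by (auto simp: m_def I_def)
  qed
  have range_M: "m' ` I = {..2 * n - 1}"
  proof -
    \<comment> \<open>The value \<open>n\<close> was taken at both 0 and \<open>n\<close>; index 0,
      the path through \<open>\<eta>\<close>, still supplies it after the change. The new value
      \<open>Suc n\<close> stays within the maximum because \<open>n > 1\<close>.\<close>
    have "r \<in> m' ` I" if "r \<le> 2 * n - 1" for r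
      using that assms(1)
      by (cases "r = n", intro image_eqI[of _ _ 0])
        (auto simp: m_def m'_def I_def intro!: image_eqI[of _ _ "2 * n - r"])
    then show ?thesis using assms(1) by (auto simp: m_def m'_def I_def)
  qed
  have tails: "sat M Obs \<phi> \<pi> (l + 1) = sat K Obs \<phi> \<pi> (l + 1)"
    if \<phi>: "balanced \<phi>" "len \<phi> < n" and \<pi>: "initial_path K \<pi>" for \<phi> :: "('p, 'a) kctl" and \<pi>
  proof -
    obtain k where k: "k \<in> I" "\<pi> = P k" using \<pi> paths by auto
    have "sat K Obs \<phi> (P k) (l + 1 + 0) =
        tail_sat p Obs \<phi> (m k - 0) (2 * n - 1 - 0 - (m k - 0))"
    proof (rule sat_iff_tail_sat[where P = P and I = I and m = m and b = "l + 1" and k = k])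
      show "k = k'"
        if "k \<in> I" "k' \<in> I" "\<And>j. j < l + 1 \<Longrightarrow> label K (P k j) = label K (P k' j)" for k k'
        using that by (rule distinct)
    qed (fact paths tail prefix range k(1))+
    moreover have "sat M Obs \<phi> (P k) (l + 1 + 0) =
        tail_sat p Obs \<phi> (m' k - 0) (2 * n - 1 - 0 - (m' k - 0))"
    proof (rule sat_iff_tail_sat[where P = P and I = I and m = m' and b = "l + 1" and k = k])
      show "initial_path M \<pi> \<longleftrightarrow> \<pi> \<in> P ` I" for \<pi>
        unfolding paths_M by (rule paths)
      show "label M (P k j) \<subseteq> {p}" if "k \<in> I" "j < l + 1" for k j
        unfolding head_M[OF that] by (rule prefix[OF that])
      show "k = k'"
        if "k \<in> I" "k' \<in> I" "\<And>j. j < l + 1 \<Longrightarrow> label M (P k j) = label M (P k' j)" for k k'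
        using that head_M by (intro distinct) auto
    qed (fact tail_M range_M k(1))+
    moreover have "tail_sat p Obs \<phi> (m k) (2 * n - 1 - m k) =
        tail_sat p Obs \<phi> (m' k) (2 * n - 1 - m' k)"
    proof (cases "k = n")
      case True
      \<comment> \<open>The change is split through \<open>(Suc n, n - 1)\<close>. Lowering
        \<open>g\<close> to \<open>n - 2\<close> needs \<open>len \<phi> \<le> n - 1\<close>,
        exactly what the offset by one in \<open>stable_right\<close> allows.\<close>
      have "tail_sat p Obs \<phi> n (n - 1) = tail_sat p Obs \<phi> (Suc n) (n - 1)"
        using \<phi>(2) by (intro stable_left[OF stable_tail_sat[OF \<phi>(1)]]) simp
      also have "\<dots> = tail_sat p Obs \<phi> (Suc n) (n - 2)"
      proof -
        have "n - 1 = Suc (n - 2)" using assms(1) by simp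
        then show ?thesis
          using \<phi>(2) stable_right[OF stable_tail_sat[OF \<phi>(1)], where r = "Suc n" and g = "n - 2"]
          by simp
      qed
      finally show ?thesis
        using True assms(1) by (simp add: m_def m'_def numeral_2_eq_2 mult_2)
    next
      case False
      then show ?thesis by (simp add: m'_def)
    qed
    ultimately show ?thesis unfolding k(2) by simp
  qed
  have "sat M Obs \<psi> \<pi> 0 = sat K Obs \<psi> \<pi> 0" if "initial_path K \<pi>" for \<pi>
  proof (rule sat_eq_before[where b = "l + 1" and n = n])
    show "label M (\<pi> i) = label K (\<pi> i)" if "initial_path K \<pi>" "i < l + 1" for \<pi> i
      using that head_M paths by auto
  qed (use paths_M tails assms that in auto)
  then show ?thesis unfolding models_def paths_M by blast
qed

end
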